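(* Let $d_1\ne0$ and suppose that $p_1=Bh$ and $B=2A$. Then the coefficients of the equation $$\frac{d^2u}{dx^2}+a(x)\frac{du}{dx}+b(x)u=0,\qquad a=\frac{P_9}{xP_6P_3},\quad b=\frac{P_3Q_3}{4x^2P_6}$$ (which describes the motion of a heavy gyrostat with a fixed point in the Hess--Sretensky case) take the form $$a(x)=\frac{x^4-4h^2+4}{\left(x^4+4(A^2-h)x^2+4h^2-4\right)x},\qquad b(x)=\frac{d_1^2x^2}{x^4+4(A^2-h)x^2+4h^2-4},$$ and its general solution is $$u(x)=C_1\cos\Phi(x)+C_2\sin\Phi(x),\qquad \Phi(x)=\int\frac{d_1x}{\sqrt{x^4+4(A^2-h)x^2+4h^2-4}}\,dx,$$ where $C_1,C_2$ are arbitrary constants (on any interval not containing $0$ or a zero of the quartic under the root, with any fixed branch of the square root). In particular, the equation has liouvillian solutions.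
   Context: Let $A,B,p_1\in\mathbb R$, $h\in[-1,+\infty)$, $d_1\in(-1,0]$ be parameters, and $$P_3=2d_1x^3+(B-2A)x^2+2(Bh-p_1),\qquad Q_3=4d_1x^3-P_3,$$ $$P_6=x^6+(B^2-4h)x^4+4\bigl(h^2-1-B(Bh-p_1)\bigr)x^2+4(Bh-p_1)^2,\qquad P_9=(P_3-xP_3')P_6+\tfrac12xP_3P_6'.$$ Liouvillian functions are elements of differential fields obtained from $\mathbb C(x)$ by a finite tower of extensions, each obtained by adjoining an indefinite integral, an exponential of an indefinite integral, or an algebraic element. *)

theory Defs
  imports "HOL-Complex_Analysis.Complex_Analysis"
begin

section \<open>The coefficients of the equation\<close>

definition P3 :: "real \<Rightarrow> real \<Rightarrow> real \<Rightarrow> real \<Rightarrow> real \<Rightarrow> real poly" where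
  "P3 A B p1 h d1 = [:2 * (B * h - p1), 0, B - 2 * A, 2 * d1:]"

definition Q3 :: "real \<Rightarrow> real \<Rightarrow> real \<Rightarrow> real \<Rightarrow> real \<Rightarrow> real poly" where
  "Q3 A B p1 h d1 = monom (4 * d1) 3 - P3 A B p1 h d1"

definition P6 :: "real \<Rightarrow> real \<Rightarrow> real \<Rightarrow> real poly" where
  "P6 B p1 h =
     [:4 * (B * h - p1)^2, 0, 4 * (h^2 - 1 - B * (B * h - p1)), 0, B^2 - 4 * h, 0, 1:]"

definition P9 :: "real \<Rightarrow> real \<Rightarrow> real \<Rightarrow> real \<Rightarrow> real \<Rightarrow> real poly" where
  "P9 A B p1 h d1 =
     (P3 A B p1 h d1 - monom 1 1 * pderiv (P3 A B p1 h d1)) * P6 B p1 h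
     + smult (1/2) (monom 1 1 * P3 A B p1 h d1 * pderiv (P6 B p1 h))"

definition coeff_a :: "real \<Rightarrow> real \<Rightarrow> real \<Rightarrow> real \<Rightarrow> real \<Rightarrow> real \<Rightarrow> real" where
  "coeff_a A B p1 h d1 x =
     poly (P9 A B p1 h d1) x / (x * poly (P6 B p1 h) x * poly (P3 A B p1 h d1) x)"

definition coeff_b :: "real \<Rightarrow> real \<Rightarrow> real \<Rightarrow> real \<Rightarrow> real \<Rightarrow> real \<Rightarrow> real" where
  "coeff_b A B p1 h d1 x =
     poly (P3 A B p1 h d1) x * poly (Q3 A B p1 h d1) x / (4 * x^2 * poly (P6 B p1 h) x)"

definition quartic :: "real \<Rightarrow> real \<Rightarrow> real \<Rightarrow> real" where
  "quartic A h x = x^4 + 4 * (A^2 - h) * x^2 + 4 * h^2 - 4"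

section \<open>Solutions on a real interval\<close>

text \<open>
  Unknown functions are complex-valued functions of a real variable, because the quartic may be
  negative on the interval. All derivatives are taken within \<open>I\<close>, i.e. they are one-sided at an
  endpoint that belongs to \<open>I\<close>.
\<close>

definition solves_on ::
    "(real \<Rightarrow> real) \<Rightarrow> (real \<Rightarrow> real) \<Rightarrow> real set \<Rightarrow> (real \<Rightarrow> complex) \<Rightarrow> bool" where
  "solves_on a b I u \<longleftrightarrow>
     (\<exists>u' u''. \<forall>x\<in>I.
        (u has_vector_derivative u' x) (at x within I) \<and>
        (u' has_vector_derivative u'' x) (at x within I) \<and>
        u'' x + of_real (a x) * u' x + of_real (b x) * u x = 0)"

definition sqrt_branch_on :: "(real \<Rightarrow> real) \<Rightarrow> real set \<Rightarrow> (real \<Rightarrow> complex) \<Rightarrow> bool" where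
  "sqrt_branch_on f I s \<longleftrightarrow> continuous_on I s \<and> (\<forall>x\<in>I. s x ^ 2 = of_real (f x))"

definition antiderivative_on :: "(real \<Rightarrow> complex) \<Rightarrow> real set \<Rightarrow> (real \<Rightarrow> complex) \<Rightarrow> bool" where
  "antiderivative_on f I F \<longleftrightarrow> (\<forall>x\<in>I. (F has_vector_derivative f x) (at x within I))"

definition admissible_interval :: "real \<Rightarrow> real \<Rightarrow> real set \<Rightarrow> bool" where
  "admissible_interval A h I \<longleftrightarrow>
     is_interval I \<and> (\<exists>x\<in>I. \<exists>y\<in>I. x < y) \<and> 0 \<notin> I \<and> (\<forall>x\<in>I. quartic A h x \<noteq> 0)"

section \<open>Liouvillian functions\<close>

text \<open>
  The differential fields are fields of meromorphic functions on a domain \<open>U\<close>. HOL functions are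
  total, so two functions represent the same field element iff they agree on \<open>U\<close> off a set that is
  sparse in \<open>U\<close>. Instead of passing to the quotient, a field is represented by the set of all
  representatives of its elements. With these conventions \<open>f / 0 = 0\<close> and \<open>deriv f\<close> at a pole
  of \<open>f\<close> are harmless.
\<close>

definition mero_eq :: "complex set \<Rightarrow> (complex \<Rightarrow> complex) \<Rightarrow> (complex \<Rightarrow> complex) \<Rightarrow> bool" where
  "mero_eq U f g \<longleftrightarrow> eventually (\<lambda>z. f z = g z) (cosparse U)"

definition differential_field :: "complex set \<Rightarrow> (complex \<Rightarrow> complex) set \<Rightarrow> bool" where
  "differential_field U F \<longleftrightarrow>
     (\<forall>f\<in>F. f meromorphic_on U) \<and>
     (\<forall>f\<in>F. \<forall>g. mero_eq U f g \<longrightarrow> g \<in> F) \<and>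
     (\<lambda>_. 0) \<in> F \<and> (\<lambda>_. 1) \<in> F \<and>
     (\<forall>f\<in>F. \<forall>g\<in>F. (\<lambda>z. f z + g z) \<in> F \<and> (\<lambda>z. f z * g z) \<in> F) \<and>
     (\<forall>f\<in>F. (\<lambda>z. - f z) \<in> F \<and> (\<lambda>z. inverse (f z)) \<in> F \<and> deriv f \<in> F)"

definition rational_functions :: "complex set \<Rightarrow> (complex \<Rightarrow> complex) set" where
  "rational_functions U =
     {f. \<exists>p q :: complex poly. q \<noteq> 0 \<and> mero_eq U f (\<lambda>z. poly p z / poly q z)}"

definition adjoin ::
    "complex set \<Rightarrow> (complex \<Rightarrow> complex) set \<Rightarrow> (complex \<Rightarrow> complex) \<Rightarrow> (complex \<Rightarrow> complex) set" where
  "adjoin U F t = \<Inter>{E. differential_field U E \<and> F \<subseteq> E \<and> t \<in> E}"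

definition algebraic_over ::
    "complex set \<Rightarrow> (complex \<Rightarrow> complex) set \<Rightarrow> (complex \<Rightarrow> complex) \<Rightarrow> bool" where
  "algebraic_over U F t \<longleftrightarrow>
     (\<exists>(n::nat) c. (\<forall>i\<le>n. c i \<in> F) \<and> \<not> mero_eq U (c n) (\<lambda>_. 0) \<and>
        mero_eq U (\<lambda>z. \<Sum>i\<le>n. c i z * t z ^ i) (\<lambda>_. 0))"

text \<open>
  An exponential \<open>t\<close> of an indefinite integral of \<open>f\<close> is a nonzero \<open>t\<close> with \<open>t' = f t\<close>; the
  integral itself need not be single-valued on \<open>U\<close>.
\<close>

inductive liouvillian_field :: "complex set \<Rightarrow> (complex \<Rightarrow> complex) set \<Rightarrow> bool" for U where
  rational: "liouvillian_field U (rational_functions U)"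
| integral: "liouvillian_field U (adjoin U F t)"
    if "liouvillian_field U F" "t meromorphic_on U" "deriv t \<in> F"
| exponential: "liouvillian_field U (adjoin U F t)"
    if "liouvillian_field U F" "t meromorphic_on U" "\<not> mero_eq U t (\<lambda>_. 0)"
       "(\<lambda>z. deriv t z / t z) \<in> F"
| algebraic: "liouvillian_field U (adjoin U F t)"
    if "liouvillian_field U F" "t meromorphic_on U" "algebraic_over U F t"

definition liouvillian_on :: "real set \<Rightarrow> (real \<Rightarrow> complex) \<Rightarrow> bool" where
  "liouvillian_on I u \<longleftrightarrow>
     (\<exists>U F f. open U \<and> connected U \<and> of_real ` I \<subseteq> U \<and> liouvillian_field U F \<and> f \<in> F \<and>
        f analytic_on (of_real ` I) \<and> (\<forall>x\<in>I. f (of_real x) = u x))"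

end

theory Submission
  imports Defs
begin

text \<open>
  With \<open>R\<close> the quartic, the reduced coefficients are \<open>a = R' / (2 R) - 1 / x\<close> and
  \<open>b = (d1 x)\<^sup>2 / R\<close>, so \<open>g = d1 x / s\<close> with \<open>s\<^sup>2 = R\<close> satisfies \<open>g' = - a g\<close> and \<open>g\<^sup>2 = b\<close>:
  in the variable \<open>\<Phi> = \<integral> g\<close> the equation becomes the harmonic oscillator. Since \<open>R\<close> has finitely
  many roots, none of them on \<open>I\<close>, an intersection of half-planes is a convex neighbourhood of \<open>I\<close>
  on which both \<open>s\<close> and \<open>\<Phi>\<close> are holomorphic, and \<open>s\<close> (algebraic), then \<open>exp (\<i> \<Phi>)\<close> (exponential
  of an integral) generate a liouvillian tower containing every solution.
\<close>

section \<open>The constant-coefficient equation behind the reduced equation\<close>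

lemma vector_derivative_zero_imp_constant:
  fixes f :: "real \<Rightarrow> 'a::real_normed_vector"
  assumes "is_interval I"
    and "\<And>x. x \<in> I \<Longrightarrow> (f has_vector_derivative 0) (at x within I)"
  shows "\<exists>c. \<forall>x\<in>I. f x = c"
  using has_vector_derivative_zero_constant[OF is_interval_convex[OF assms(1)] assms(2)] by metis

text \<open>With \<open>v = u' / g\<close> the equation becomes the system \<open>u' = g v\<close>,
  \<open>v' = - g u\<close>, a rotation at speed \<open>g\<close>. Hence \<open>(u, v)\<close> is
  constant in a frame turned by the angle \<open>\<Phi>\<close>.\<close>

lemma solves_on_iff_trig:
  fixes a b :: "real \<Rightarrow> real" and \<Phi> g :: "real \<Rightarrow> complex"
  assumes I: "is_interval I"
    and \<Phi>: "\<And>x. x \<in> I \<Longrightarrow> (\<Phi> has_vector_derivative g x) (at x within I)"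
    and g: "\<And>x. x \<in> I \<Longrightarrow> (g has_vector_derivative - of_real (a x) * g x) (at x within I)"
    and g0: "\<And>x. x \<in> I \<Longrightarrow> g x \<noteq> 0"
    and b: "\<And>x. x \<in> I \<Longrightarrow> of_real (b x) = g x ^ 2"
  shows "solves_on a b I u \<longleftrightarrow> (\<exists>C1 C2. \<forall>x\<in>I. u x = C1 * cos (\<Phi> x) + C2 * sin (\<Phi> x))"
proof
  have dcos: "((\<lambda>x. cos (\<Phi> x)) has_vector_derivative - sin (\<Phi> x) * g x) (at x within I)"
    and dsin: "((\<lambda>x. sin (\<Phi> x)) has_vector_derivative cos (\<Phi> x) * g x) (at x within I)"
    if "x \<in> I" for x
    using field_vector_diff_chain_within[OF \<Phi>[OF that], of cos "- sin (\<Phi> x)"]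
      field_vector_diff_chain_within[OF \<Phi>[OF that], of sin "cos (\<Phi> x)"]
    by (auto simp: o_def mult.commute has_field_derivative_at_within)
  note mult = bounded_bilinear.has_vector_derivative[OF bounded_bilinear_mult]
  {
    assume "solves_on a b I u"
    then obtain u' u'' where
      u: "\<And>x. x \<in> I \<Longrightarrow> (u has_vector_derivative u' x) (at x within I)" and
      u': "\<And>x. x \<in> I \<Longrightarrow> (u' has_vector_derivative u'' x) (at x within I)" and
      ode: "\<And>x. x \<in> I \<Longrightarrow> u'' x + of_real (a x) * u' x + of_real (b x) * u x = 0"
      unfolding solves_on_def by blast
    \<comment> \<open>\<open>v\<close> is the derivative of \<open>u\<close> with respect to
      \<open>\<Phi>\<close>; the term \<open>a u'\<close> cancels in \<open>v'\<close> because
      \<open>g' = - a g\<close>.\<close>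
    define v where "v = (\<lambda>x. u' x * inverse (g x))"
    have u'_eq: "u' x = g x * v x" if "x \<in> I" for x
      using g0[OF that] by (simp add: v_def)
    have v: "(v has_vector_derivative - (g x * u x)) (at x within I)" if x: "x \<in> I" for x
    proof -
      have "((\<lambda>x. inverse (g x)) has_vector_derivative
              (- of_real (a x) * g x) * - (inverse (g x) * inverse (g x))) (at x within I)"
        using field_vector_diff_chain_within[OF g[OF x], of inverse "- (inverse (g x) * inverse (g x))"]
          DERIV_inverse'[OF DERIV_ident, of "g x"] g0[OF x]
        by (auto simp: o_def)
      from mult[OF u'[OF x] this]
      have "(v has_vector_derivative
              u' x * ((- of_real (a x) * g x) * - (inverse (g x) * inverse (g x))) + u'' x * inverse (g x))
            (at x within I)"
        by (simp add: v_def)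
      moreover have u''_eq: "u'' x = - of_real (a x) * u' x - g x ^ 2 * u x"
        using ode[OF x] b[OF x] by (simp add: algebra_simps eq_neg_iff_add_eq_0)
      have "u' x * ((- of_real (a x) * g x) * - (inverse (g x) * inverse (g x))) + u'' x * inverse (g x)
          = - (g x * u x)"
        unfolding u''_eq using g0[OF x] by (simp add: field_simps power2_eq_square)
      ultimately show ?thesis by simp
    qed
    \<comment> \<open>Undoing the rotation of \<open>(u, v)\<close> gives two first integrals, whose
      constant values are \<open>C1\<close> and \<open>C2\<close>.\<close>
    have "((\<lambda>x. u x * cos (\<Phi> x) - v x * sin (\<Phi> x)) has_vector_derivative 0) (at x within I)"
      if x: "x \<in> I" for x
      using has_vector_derivative_diff[OF mult[OF u[OF x] dcos[OF x]] mult[OF v[OF x] dsin[OF x]]]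
      by (simp add: u'_eq[OF x] algebra_simps)
    then have "\<exists>C. \<forall>x\<in>I. u x * cos (\<Phi> x) - v x * sin (\<Phi> x) = C"
      by (rule vector_derivative_zero_imp_constant[OF I])
    then obtain C1 where C1: "\<And>x. x \<in> I \<Longrightarrow> u x * cos (\<Phi> x) - v x * sin (\<Phi> x) = C1"
      by blast
    have "((\<lambda>x. u x * sin (\<Phi> x) + v x * cos (\<Phi> x)) has_vector_derivative 0) (at x within I)"
      if x: "x \<in> I" for x
      using has_vector_derivative_add[OF mult[OF u[OF x] dsin[OF x]] mult[OF v[OF x] dcos[OF x]]]
      by (simp add: u'_eq[OF x] algebra_simps)
    then have "\<exists>C. \<forall>x\<in>I. u x * sin (\<Phi> x) + v x * cos (\<Phi> x) = C"
      by (rule vector_derivative_zero_imp_constant[OF I])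
    then obtain C2 where C2: "\<And>x. x \<in> I \<Longrightarrow> u x * sin (\<Phi> x) + v x * cos (\<Phi> x) = C2"
      by blast
    have "u x = C1 * cos (\<Phi> x) + C2 * sin (\<Phi> x)" if x: "x \<in> I" for x
    proof -
      have "C1 * cos (\<Phi> x) + C2 * sin (\<Phi> x) = u x * ((sin (\<Phi> x))^2 + (cos (\<Phi> x))^2)"
        unfolding C1[OF x, symmetric] C2[OF x, symmetric]
        by algebra
      then show ?thesis by simp
    qed
    then show "\<exists>C1 C2. \<forall>x\<in>I. u x = C1 * cos (\<Phi> x) + C2 * sin (\<Phi> x)" by blast
  }
  {
    assume "\<exists>C1 C2. \<forall>x\<in>I. u x = C1 * cos (\<Phi> x) + C2 * sin (\<Phi> x)"
    then obtain C1 C2 where u_eq: "\<And>x. x \<in> I \<Longrightarrow> u x = C1 * cos (\<Phi> x) + C2 * sin (\<Phi> x)" by blast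
    \<comment> \<open>\<open>w\<close> takes the role of \<open>v\<close>: the formal derivative of
      the trigonometric expression with respect to \<open>\<Phi>\<close>.\<close>
    define w where "w = (\<lambda>x. C2 * cos (\<Phi> x) - C1 * sin (\<Phi> x))"
    have u: "(u has_vector_derivative g x * w x) (at x within I)" if x: "x \<in> I" for x
    proof (rule has_vector_derivative_transform[OF x u_eq])
      show "((\<lambda>x. C1 * cos (\<Phi> x) + C2 * sin (\<Phi> x)) has_vector_derivative g x * w x) (at x within I)"
        using has_vector_derivative_add[OF has_vector_derivative_mult_right[OF dcos[OF x], of C1]
          has_vector_derivative_mult_right[OF dsin[OF x], of C2]]
        by (simp add: w_def algebra_simps)
    qed
    have w: "(w has_vector_derivative - (g x * u x)) (at x within I)" if x: "x \<in> I" for x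
    proof -
      have "(w has_vector_derivative C2 * (- sin (\<Phi> x) * g x) - C1 * (cos (\<Phi> x) * g x)) (at x within I)"
        unfolding w_def
        using has_vector_derivative_diff[OF has_vector_derivative_mult_right[OF dcos[OF x], of C2]
            has_vector_derivative_mult_right[OF dsin[OF x], of C1]] .
      also have "C2 * (- sin (\<Phi> x) * g x) - C1 * (cos (\<Phi> x) * g x) = - (g x * u x)"
        by (simp add: u_eq[OF x] algebra_simps)
      finally show ?thesis .
    qed
    show "solves_on a b I u"
      unfolding solves_on_def
    proof (intro exI ballI conjI)
      fix x assume x: "x \<in> I"
      show "(u has_vector_derivative (\<lambda>x. g x * w x) x) (at x within I)"
        using u[OF x] by simp
      show "((\<lambda>x. g x * w x) has_vector_derivative
          (\<lambda>x. g x * - (g x * u x) + - of_real (a x) * g x * w x) x) (at x within I)"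
        using mult[OF g[OF x] w[OF x]] by simp
      show "(\<lambda>x. g x * - (g x * u x) + - of_real (a x) * g x * w x) x
          + of_real (a x) * (\<lambda>x. g x * w x) x + of_real (b x) * u x = 0"
        by (simp add: b[OF x] power2_eq_square algebra_simps)
    qed
  }
qed

text \<open>The quotient \<open>s / s0\<close> is continuous with values in \<open>{1, -1}\<close>,
  hence constant on a connected set. This carries results from one holomorphic branch to every
  continuous one.\<close>

lemma sqrt_branch_unique:
  fixes s s0 :: "real \<Rightarrow> complex"
  assumes "connected I" "continuous_on I s" "continuous_on I s0"
    and sq: "\<And>x. x \<in> I \<Longrightarrow> s x ^ 2 = s0 x ^ 2" and nz: "\<And>x. x \<in> I \<Longrightarrow> s0 x \<noteq> 0"
  obtains e where "e = 1 \<or> e = -1" "\<And>x. x \<in> I \<Longrightarrow> s x = e * s0 x"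
proof -
  have pm: "s x / s0 x = 1 \<or> s x / s0 x = -1" if "x \<in> I" for x
    using sq[OF that] nz[OF that] by (auto simp: power2_eq_iff)
  have "continuous_on I (\<lambda>x. s x / s0 x)"
    using assms by (intro continuous_on_divide) auto
  moreover have "finite ((\<lambda>x. s x / s0 x) ` I)"
    by (rule finite_subset[of _ "{1, -1}"]) (use pm in blast, simp)
  ultimately have "(\<lambda>x. s x / s0 x) constant_on I"
    using continuous_finite_range_constant[OF assms(1)] by blast
  then obtain e where e: "\<And>x. x \<in> I \<Longrightarrow> s x / s0 x = e"
    unfolding constant_on_def by blast
  show thesis
  \<comment> \<open>Only a point of \<open>I\<close> forces \<open>e\<close> to be a sign; on the
    empty set the sign 1 is picked by hand.\<close>
  proof (cases "I = {}")
    case True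
    then show ?thesis using that[of 1] by simp
  next
    case False
    then show ?thesis
      using that[of e] e pm nz by (metis all_not_in_conv nonzero_eq_divide_eq)
  qed
qed

section \<open>Uniformising the square root near the interval\<close>

text \<open>The boundary line is drawn through \<open>w\<close>: vertical for real \<open>w\<close>,
  which has the whole interval on one side, and horizontal otherwise.\<close>

lemma real_interval_avoiding_halfplane:
  assumes "is_interval I" "w \<notin> complex_of_real ` I"
  obtains H where "open H" "convex H" "of_real ` I \<subseteq> H" "w \<notin> H"
proof (cases "Im w = 0")
  case True
  then have w: "Re w \<notin> I"
    using assms(2) by (metis complex_is_Real_iff image_eqI of_real_Re)
  have "(\<forall>x\<in>I. x < Re w) \<or> (\<forall>x\<in>I. Re w < x)"
    using w assms(1) unfolding is_interval_1 by (metis linorder_cases less_imp_le)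
  then show ?thesis
    using that[of "{z. Re z < Re w}"] that[of "{z. Re z > Re w}"]
    by (auto simp: open_halfspace_Re_lt open_halfspace_Re_gt convex_halfspace_Re_lt
        convex_halfspace_Re_gt image_subset_iff)
next
  case False
  then consider "Im w > 0" | "Im w < 0" by linarith
  then show ?thesis
    using that[of "{z. Im z < Im w}"] that[of "{z. Im z > Im w}"]
    by cases (auto simp: open_halfspace_Im_lt open_halfspace_Im_gt convex_halfspace_Im_lt
        convex_halfspace_Im_gt image_subset_iff)
qed

text \<open>Intersecting one half-plane per point of \<open>Z\<close> keeps convexity, and
  finiteness of \<open>Z\<close> keeps openness. Convexity later yields the square root, its
  primitive and connectedness.\<close>

lemma real_interval_convex_neighbourhood:
  assumes "is_interval I" "finite Z" "Z \<inter> complex_of_real ` I = {}"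
  obtains U where "open U" "convex U" "of_real ` I \<subseteq> U" "Z \<inter> U = {}"
proof -
  have "\<forall>w\<in>Z. \<exists>H. open H \<and> convex H \<and> complex_of_real ` I \<subseteq> H \<and> w \<notin> H"
  proof
    fix w assume "w \<in> Z"
    with assms(3) have "w \<notin> complex_of_real ` I" by blast
    then show "\<exists>H. open H \<and> convex H \<and> complex_of_real ` I \<subseteq> H \<and> w \<notin> H"
      by (rule real_interval_avoiding_halfplane[OF assms(1)]) (intro exI conjI)
  qed
  from bchoice[OF this] obtain H where
    H: "\<forall>w\<in>Z. open (H w) \<and> convex (H w) \<and> complex_of_real ` I \<subseteq> H w \<and> w \<notin> H w" ..
  show ?thesis
  proof (rule that[of "\<Inter>w\<in>Z. H w"])
    show "open (\<Inter>w\<in>Z. H w)" using H assms(2) by blast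
    show "convex (\<Inter>w\<in>Z. H w)" by (intro convex_INT) (use H in blast)
    show "of_real ` I \<subseteq> (\<Inter>w\<in>Z. H w)" using H by blast
    show "Z \<inter> (\<Inter>w\<in>Z. H w) = {}" using H by blast
  qed
qed

text \<open>Only the roots of \<open>q\<close> are cut out of \<open>U\<close>. A zero-free function
  on a contractible set has a holomorphic root \<open>S\<close>, which is again zero-free, so
  \<open>r / S\<close> has a primitive on the convex set \<open>U\<close>.\<close>

lemma holomorphic_sqrt_primitive_near_interval:
  fixes q r :: "complex poly"
  assumes "is_interval I" "q \<noteq> 0" "\<And>x. x \<in> I \<Longrightarrow> poly q (of_real x) \<noteq> 0"
  obtains U S T where "open U" "convex U" "of_real ` I \<subseteq> U"
    "S holomorphic_on U" "\<And>z. z \<in> U \<Longrightarrow> S z ^ 2 = poly q z" "\<And>z. z \<in> U \<Longrightarrow> S z \<noteq> 0"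
    "\<And>z. z \<in> U \<Longrightarrow> (T has_field_derivative poly r z / S z) (at z)"
proof -
  have "{z. poly q z = 0} \<inter> complex_of_real ` I = {}"
    using assms(3) by auto
  then obtain U where U: "open U" "convex U" "of_real ` I \<subseteq> U" "{z. poly q z = 0} \<inter> U = {}"
    using real_interval_convex_neighbourhood[OF assms(1) poly_roots_finite[OF assms(2)]] by blast
  have nz: "poly q z \<noteq> 0" if "z \<in> U" for z
    using U(4) that by blast
  have "poly q holomorphic_on U"
    by (intro holomorphic_intros)
  from contractible_imp_holomorphic_sqrt[OF this convex_imp_contractible[OF U(2)] nz]
  obtain S where S: "S holomorphic_on U" "\<And>z. z \<in> U \<Longrightarrow> poly q z = S z ^ 2"
    by metis
  have S0: "S z \<noteq> 0" if "z \<in> U" for z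
    using nz[OF that] S(2)[OF that] by auto
  have "(\<lambda>z. poly r z / S z) holomorphic_on U"
    by (intro holomorphic_intros S) (use S0 in auto)
  then obtain T where T: "\<And>z. z \<in> U \<Longrightarrow> (T has_field_derivative poly r z / S z) (at z within U)"
    using holomorphic_convex_primitive'[OF U(2,1)] by blast
  show thesis
  proof (rule that[OF U(1-3) S(1) _ S0])
    show "S z ^ 2 = poly q z" if "z \<in> U" for z
      using S(2)[OF that] by simp
    show "(T has_field_derivative poly r z / S z) (at z)" if "z \<in> U" for z
      using T[OF that] at_within_open[OF that U(1)] by simp
  qed
qed

section \<open>Liouvillian towers\<close>

lemma mero_eq_on_open:
  assumes "open U" "\<And>z. z \<in> U \<Longrightarrow> f z = g z"
  shows "mero_eq U f g"
  unfolding mero_eq_def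
  using eventually_in_cosparse[OF subset_refl assms(1)] by eventually_elim (use assms(2) in blast)

text \<open>A nonempty open set is not sparse in itself. This settles the nonvanishing conditions on
  leading coefficients and exponentials in the tower.\<close>

lemma not_mero_eq_zero:
  assumes "open U" "U \<noteq> {}" "\<And>z. z \<in> U \<Longrightarrow> f z \<noteq> 0"
  shows "\<not> mero_eq U f (\<lambda>_. 0)"
proof
  assume "mero_eq U f (\<lambda>_. 0)"
  then have "eventually (\<lambda>z. f z = 0) (cosparse U)" by (simp add: mero_eq_def)
  with eventually_in_cosparse[OF subset_refl assms(1)]
  have "eventually (\<lambda>z. False) (cosparse U)"
    by eventually_elim (use assms(3) in blast)
  then show False using assms(2) by (simp add: eventually_False)
qed

lemma adjoin_base: "f \<in> F \<Longrightarrow> f \<in> adjoin U F t"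
  and adjoin_generator: "t \<in> adjoin U F t"
  unfolding adjoin_def by auto

text \<open>Closure conditions shared by all differential fields in a family pass to their
  intersection.\<close>

lemma adjoin_add: "f \<in> adjoin U F t \<Longrightarrow> g \<in> adjoin U F t \<Longrightarrow> (\<lambda>z. f z + g z) \<in> adjoin U F t"
  and adjoin_mult: "f \<in> adjoin U F t \<Longrightarrow> g \<in> adjoin U F t \<Longrightarrow> (\<lambda>z. f z * g z) \<in> adjoin U F t"
  and adjoin_inverse: "f \<in> adjoin U F t \<Longrightarrow> (\<lambda>z. inverse (f z)) \<in> adjoin U F t"
  and adjoin_mero_eq: "f \<in> adjoin U F t \<Longrightarrow> mero_eq U f g \<Longrightarrow> g \<in> adjoin U F t"
  unfolding adjoin_def differential_field_def by auto

lemma poly_in_rational_functions: "poly p \<in> rational_functions U"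
  unfolding rational_functions_def mero_eq_def
  by (rule CollectI, rule exI[of _ p], rule exI[of _ 1]) auto

text \<open>The tower has two steps: \<open>S\<close> is a root of \<open>X^2 - q\<close>, and
  \<open>t = exp (\<i> T)\<close> has logarithmic derivative \<open>\<i> r / S\<close>, which lies
  in the field generated by \<open>S\<close>. Cosine and sine of \<open>T\<close> are combinations
  of \<open>t\<close> and \<open>1 / t\<close>.\<close>

lemma liouvillian_on_trig_integral:
  fixes q r :: "complex poly"
  assumes U: "open U" "connected U" "of_real ` I \<subseteq> U" "I \<noteq> {}"
    and S: "S holomorphic_on U" "\<And>z. z \<in> U \<Longrightarrow> S z ^ 2 = poly q z"
    and T: "\<And>z. z \<in> U \<Longrightarrow> (T has_field_derivative poly r z / S z) (at z)"
  shows "liouvillian_on I (\<lambda>x. C1 * cos (T (of_real x)) + C2 * sin (T (of_real x)))"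
proof -
  have "U \<noteq> {}" using U by auto
  have poly_const: "(\<lambda>_. c) \<in> rational_functions U" for c
  proof -
    have "poly [:c:] = (\<lambda>_. c)" by auto
    then show ?thesis using poly_in_rational_functions[of "[:c:]" U] by metis
  qed
  define t where "t = (\<lambda>z. exp (\<i> * T z))"
  define F1 where "F1 = adjoin U (rational_functions U) S"
  have T_holo: "T holomorphic_on U"
    using T U(1) holomorphic_on_open by blast
  then have t_holo: "t holomorphic_on U"
    unfolding t_def by (intro holomorphic_intros)
  have mero: "f meromorphic_on U" if "f holomorphic_on U" for f
    using that U(1) by (simp add: analytic_on_open analytic_on_imp_meromorphic_on)
  have alg: "algebraic_over U (rational_functions U) S"
    unfolding algebraic_over_def
  proof (intro exI conjI)
    \<comment> \<open>These are the coefficients of \<open>X^2 - q\<close>, by ascending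
      degree.\<close>
    let ?c = "\<lambda>i::nat. poly (if i = 0 then - q else if i = 1 then 0 else 1)"
    show "\<forall>i\<le>2. ?c i \<in> rational_functions U" using poly_in_rational_functions by blast
    show "\<not> mero_eq U (?c 2) (\<lambda>_. 0)"
      using U(1) \<open>U \<noteq> {}\<close> by (intro not_mero_eq_zero) auto
    show "mero_eq U (\<lambda>z. \<Sum>i\<le>2. ?c i z * S z ^ i) (\<lambda>_. 0)"
      by (intro mero_eq_on_open U) (simp add: S(2)[symmetric] numeral_2_eq_2)
  qed
  have F1: "liouvillian_field U F1"
    unfolding F1_def
    by (intro liouvillian_field.algebraic liouvillian_field.rational mero S alg)
  have "(\<lambda>z. deriv t z / t z) \<in> F1"
    unfolding F1_def
  \<comment> \<open>The representative built from field operations is only known to agree with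
    \<open>deriv t / t\<close> on \<open>U\<close>, so representatives are switched.\<close>
  proof (rule adjoin_mero_eq)
    show "(\<lambda>z. poly (smult \<i> r) z * inverse (S z)) \<in> adjoin U (rational_functions U) S"
      by (intro adjoin_mult adjoin_inverse adjoin_generator adjoin_base poly_in_rational_functions)
    show "mero_eq U (\<lambda>z. poly (smult \<i> r) z * inverse (S z)) (\<lambda>z. deriv t z / t z)"
    proof (rule mero_eq_on_open[OF U(1)])
      fix z assume "z \<in> U"
      have "(t has_field_derivative t z * (\<i> * (poly r z / S z))) (at z)"
        unfolding t_def by (auto intro!: derivative_eq_intros T \<open>z \<in> U\<close>)
      then show "poly (smult \<i> r) z * inverse (S z) = deriv t z / t z"
        by (simp add: DERIV_imp_deriv t_def divide_inverse)
    qed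
  qed
  then have F2: "liouvillian_field U (adjoin U F1 t)"
    using F1 mero[OF t_holo] not_mero_eq_zero[OF U(1) \<open>U \<noteq> {}\<close>, of t]
    by (intro liouvillian_field.exponential) (auto simp: t_def)
  \<comment> \<open>Euler's formulas turn \<open>C1 cos T + C2 sin T\<close> into this combination
    of \<open>exp (\<i> T)\<close> and \<open>exp (- \<i> T)\<close>.\<close>
  define f where
    "f = (\<lambda>z. (C1 - \<i> * C2) / 2 * t z + (C1 + \<i> * C2) / 2 * inverse (t z))"
  have "(\<lambda>_. c) \<in> adjoin U F1 t" for c
    unfolding F1_def by (intro adjoin_base poly_const)
  then have "f \<in> adjoin U F1 t"
    unfolding f_def by (intro adjoin_add adjoin_mult adjoin_inverse adjoin_generator)
  moreover have "f holomorphic_on U"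
    unfolding f_def by (intro holomorphic_intros t_holo) (auto simp: t_def)
  then have "f analytic_on of_real ` I"
    using U by (meson analytic_on_open analytic_on_subset)
  moreover have "f z = C1 * cos (T z) + C2 * sin (T z)" for z
    unfolding f_def t_def cos_exp_eq sin_exp_eq exp_minus[symmetric]
    by (simp add: field_simps)
  ultimately show ?thesis
    unfolding liouvillian_on_def using U F2 by blast
qed

section \<open>The reduced equation\<close>

text \<open>Here \<open>B h - p1 = 0\<close>, so the constant term of \<open>P6\<close> vanishes,
  and \<open>B^2 - 4 h = 4 (A^2 - h)\<close>.\<close>

lemma P6_reduced: "poly (P6 (2 * A) (2 * A * h) h) x = x\<^sup>2 * quartic A h x"
  by (simp add: P6_def quartic_def algebra_simps power2_eq_square power4_eq_xxxx)

text \<open>\<open>P3\<close> collapses to \<open>2 d1 x^3\<close>, and with \<open>R\<close> the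
  quartic \<open>P9\<close> becomes \<open>d1 x^5 (x R' - 2 R)\<close>. The common factor
  \<open>2 d1 x^5\<close> then cancels, which uses \<open>d1 \<noteq> 0\<close>.\<close>

lemma coeff_a_reduced:
  assumes "d1 \<noteq> 0" "x \<noteq> 0" "quartic A h x \<noteq> 0"
  shows "coeff_a A (2 * A) (2 * A * h) h d1 x = (x^4 - 4 * h^2 + 4) / (quartic A h x * x)"
proof -
  have "poly (P9 A (2 * A) (2 * A * h) h d1) x = 2 * d1 * x^5 * (x^4 - 4 * h^2 + 4)"
    by (simp add: P9_def P3_def P6_def pderiv_pCons poly_monom)
      (simp add: field_simps eval_nat_numeral)
  moreover have "poly (P3 A (2 * A) (2 * A * h) h d1) x = 2 * d1 * x^3"
    by (simp add: P3_def power3_eq_cube)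
  ultimately show ?thesis
    using assms by (simp add: coeff_a_def P6_reduced divide_simps eval_nat_numeral)
qed

text \<open>Both \<open>P3\<close> and \<open>Q3\<close> equal \<open>2 d1 x^3\<close>, so the
  numerator is a perfect square; this makes \<open>b\<close> the square of
  \<open>d1 x / s\<close>.\<close>

lemma coeff_b_reduced:
  assumes "x \<noteq> 0" "quartic A h x \<noteq> 0"
  shows "coeff_b A (2 * A) (2 * A * h) h d1 x = d1^2 * x^2 / quartic A h x"
proof -
  have "poly (P3 A (2 * A) (2 * A * h) h d1) x = 2 * d1 * x^3"
    and "poly (Q3 A (2 * A) (2 * A * h) h d1) x = 2 * d1 * x^3"
    by (simp_all add: P3_def Q3_def poly_monom power3_eq_cube)
  then show ?thesis
    using assms by (simp add: coeff_b_def P6_reduced divide_simps eval_nat_numeral)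
qed

text \<open>The logarithmic derivative of \<open>c z / S\<close> is \<open>1 / z - S' / S\<close>,
  and \<open>S' / S = q' / (2 q)\<close> follows by differentiating \<open>S^2 = q\<close>.\<close>

lemma sqrt_integrand_derivative:
  fixes S :: "complex \<Rightarrow> complex" and q :: "complex poly"
  assumes "open U" "z \<in> U" "S holomorphic_on U" "\<And>z. z \<in> U \<Longrightarrow> S z ^ 2 = poly q z"
    and "S z \<noteq> 0" "z \<noteq> 0"
  shows "((\<lambda>z. c * z / S z) has_field_derivative
            - ((z * poly (pderiv q) z - 2 * poly q z) / (2 * poly q z * z)) * (c * z / S z)) (at z)"
proof -
  have S: "(S has_field_derivative deriv S z) (at z)"
    using assms(1-3) holomorphic_derivI by blast
  have "((\<lambda>z. S z ^ 2) has_field_derivative 2 * S z * deriv S z) (at z)"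
    by (auto intro!: derivative_eq_intros S)
  then have "(poly q has_field_derivative 2 * S z * deriv S z) (at z)"
    by (rule has_field_derivative_transform_within_open[OF _ assms(1,2)]) (use assms(4) in auto)
  then have q': "poly (pderiv q) z = 2 * S z * deriv S z"
    using DERIV_unique poly_DERIV by blast
  have "((\<lambda>z. c * z / S z) has_field_derivative (c * S z - c * z * deriv S z) / (S z * S z)) (at z)"
    by (auto intro!: derivative_eq_intros S assms(5))
  moreover have "(c * S z - c * z * deriv S z) / (S z * S z)
      = - ((z * poly (pderiv q) z - 2 * poly q z) / (2 * poly q z * z)) * (c * z / S z)"
    unfolding q' assms(4)[OF assms(2), symmetric]
    using assms(5,6) by (simp add: field_simps power2_eq_square)
  ultimately show ?thesis by simp
qed

text \<open>This links complex derivatives on \<open>U\<close> to the possibly one-sided real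
  derivatives in \<open>solves_on\<close>.\<close>

lemma has_vector_derivative_of_real_comp:
  assumes "(F has_field_derivative D) (at (complex_of_real x))"
  shows "((\<lambda>x. F (of_real x)) has_vector_derivative D) (at x within I)"
proof -
  have "(complex_of_real has_vector_derivative 1) (at x within I)"
    by (auto intro!: derivative_eq_intros)
  from field_vector_diff_chain_within[OF this has_field_derivative_at_within[OF assms]]
  show ?thesis by (simp add: o_def)
qed

text \<open>Liouvillian form needs a holomorphic extension, so it is stated for one pair
  \<open>s0\<close>, \<open>\<Phi>0\<close> restricted from the complex plane. The description of
  solutions holds for any branch, as it is \<open>s0\<close> up to sign.\<close>

lemma reduced_equation_on_interval:
  fixes A h d1 :: real
  defines "a \<equiv> coeff_a A (2 * A) (2 * A * h) h d1" and "b \<equiv> coeff_b A (2 * A) (2 * A * h) h d1"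
  assumes d1: "d1 \<noteq> 0" and adm: "admissible_interval A h I"
  obtains s0 \<Phi>0 where "sqrt_branch_on (quartic A h) I s0"
    "antiderivative_on (\<lambda>x. of_real (d1 * x) / s0 x) I \<Phi>0"
    "\<And>C1 C2. liouvillian_on I (\<lambda>x. C1 * cos (\<Phi>0 x) + C2 * sin (\<Phi>0 x))"
    "\<And>s \<Phi> u. sqrt_branch_on (quartic A h) I s \<Longrightarrow>
       antiderivative_on (\<lambda>x. of_real (d1 * x) / s x) I \<Phi> \<Longrightarrow>
       solves_on a b I u \<longleftrightarrow> (\<exists>C1 C2. \<forall>x\<in>I. u x = C1 * cos (\<Phi> x) + C2 * sin (\<Phi> x))"
proof -
  have I: "is_interval I" "I \<noteq> {}" and nz: "\<And>x. x \<in> I \<Longrightarrow> x \<noteq> 0 \<and> quartic A h x \<noteq> 0"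
    using adm unfolding admissible_interval_def by auto
  define q :: "complex poly" where
    "q = [:of_real (4 * h^2 - 4), 0, of_real (4 * (A^2 - h)), 0, 1:]"
  have q: "poly q (of_real x) = of_real (quartic A h x)" for x
    by (simp add: q_def quartic_def algebra_simps power2_eq_square power4_eq_xxxx)
  \<comment> \<open>The quadratic terms cancel in \<open>x R' - 2 R\<close>, leaving twice the
    numerator of \<open>a\<close>.\<close>
  have q': "of_real x * poly (pderiv q) (of_real x) - 2 * of_real (quartic A h x)
      = of_real (2 * (x^4 - 4 * h^2 + 4))" for x
    by (simp add: q_def quartic_def pderiv_pCons algebra_simps power2_eq_square power4_eq_xxxx)
  have q0: "q \<noteq> 0" by (simp add: q_def)
  have "poly q (of_real x) \<noteq> 0" if "x \<in> I" for x
    using q nz[OF that] by simp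
  from holomorphic_sqrt_primitive_near_interval[OF I(1) q0 this, of "[:0, of_real d1:]"]
  obtain U S T where U: "open U" "convex U" "complex_of_real ` I \<subseteq> U"
    and S: "S holomorphic_on U" "\<And>z. z \<in> U \<Longrightarrow> S z ^ 2 = poly q z" "\<And>z. z \<in> U \<Longrightarrow> S z \<noteq> 0"
    and T: "\<And>z. z \<in> U \<Longrightarrow> (T has_field_derivative poly [:0, of_real d1:] z / S z) (at z)"
    by metis
  have IU: "of_real x \<in> U" if "x \<in> I" for x
    using U(3) that by blast
  define s0 where "s0 = (\<lambda>x::real. S (of_real x))"
  have s0: "sqrt_branch_on (quartic A h) I s0"
    unfolding sqrt_branch_on_def s0_def
    using S(2)[OF IU] q holomorphic_on_imp_continuous_on[OF S(1)] U(3)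
    by (auto intro!: continuous_on_compose2[of U S I complex_of_real] continuous_intros)
  have \<Phi>0: "antiderivative_on (\<lambda>x. of_real (d1 * x) / s0 x) I (\<lambda>x. T (of_real x))"
    unfolding antiderivative_on_def s0_def
    using has_vector_derivative_of_real_comp[OF T[OF IU]] by (simp add: mult.commute)
  have liou: "liouvillian_on I (\<lambda>x. C1 * cos (T (of_real x)) + C2 * sin (T (of_real x)))" for C1 C2
    using liouvillian_on_trig_integral[OF U(1) convex_connected[OF U(2)] U(3) I(2) S(1,2) T] by blast
  have "solves_on a b I u \<longleftrightarrow> (\<exists>C1 C2. \<forall>x\<in>I. u x = C1 * cos (\<Phi> x) + C2 * sin (\<Phi> x))"
    if s: "sqrt_branch_on (quartic A h) I s"
      and \<Phi>: "antiderivative_on (\<lambda>x. of_real (d1 * x) / s x) I \<Phi>" for s \<Phi> u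
  proof -
    have "s0 x \<noteq> 0" if "x \<in> I" for x
      using S(3)[OF IU[OF that]] by (simp add: s0_def)
    then obtain e where e: "e = 1 \<or> e = -1" and se: "\<And>x. x \<in> I \<Longrightarrow> s x = e * s0 x"
      using sqrt_branch_unique[of I s s0] s s0 is_interval_connected[OF I(1)]
      unfolding sqrt_branch_on_def by metis
    \<comment> \<open>\<open>s\<close> is only given as continuous, so the integrand is rewritten
      through the holomorphic \<open>S\<close>; since \<open>1 / e = e\<close>, the sign moves to
      the numerator.\<close>
    define g where "g = (\<lambda>x::real. e * of_real d1 * of_real x / S (of_real x))"
    have g_eq: "of_real (d1 * x) / s x = g x" if "x \<in> I" for x
      using e se[OF that] by (auto simp: g_def s0_def)
    show ?thesis
    proof (rule solves_on_iff_trig[OF I(1), where g = g])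
      fix x assume x: "x \<in> I"
      show "(\<Phi> has_vector_derivative g x) (at x within I)"
        using \<Phi> x g_eq[OF x] unfolding antiderivative_on_def by metis
      \<comment> \<open>The factor 2 is put back to match the quotient
        \<open>(z q' - 2 q) / (2 q z)\<close>.\<close>
      have "2 * (x^4 - 4 * h^2 + 4) / (2 * quartic A h x * x) = a x"
        using coeff_a_reduced[OF d1, of x A h] nz[OF x] by (simp add: a_def field_simps)
      from arg_cong[OF this, of complex_of_real]
      have coeff: "of_real (2 * (x^4 - 4 * h^2 + 4)) / (2 * of_real (quartic A h x) * of_real x)
          = complex_of_real (a x)"
        by (simp only: of_real_divide of_real_mult of_real_numeral)
      have "((\<lambda>z. e * of_real d1 * z / S z) has_field_derivative - of_real (a x) * g x) (at (of_real x))"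
        using sqrt_integrand_derivative[OF U(1) IU[OF x] S(1,2) S(3)[OF IU[OF x]], of "e * of_real d1"]
          nz[OF x]
        by (simp only: q q' coeff) (simp add: g_def)
      then show "(g has_vector_derivative - of_real (a x) * g x) (at x within I)"
        unfolding g_def by (rule has_vector_derivative_of_real_comp)
      show "g x \<noteq> 0"
        using e d1 nz[OF x] S(3)[OF IU[OF x]] by (auto simp: g_def)
      \<comment> \<open>The sign \<open>e\<close> disappears on squaring.\<close>
      show "of_real (b x) = g x ^ 2"
        using e coeff_b_reduced[of x A h d1] nz[OF x] S(2)[OF IU[OF x]] q[of x]
        by (auto simp: b_def g_def power_divide power_mult_distrib)
    qed
  qed
  then show thesis
    using that[OF s0 \<Phi>0 liou] by blast
qed

theorem mainTheorem4:
  fixes A B p1 h d1 :: real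
  assumes "h \<ge> -1" and "-1 < d1" and "d1 \<le> 0" and "d1 \<noteq> 0"
    and "p1 = B * h" and "B = 2 * A"
  shows
    "(\<forall>x. x \<noteq> 0 \<and> quartic A h x \<noteq> 0 \<longrightarrow>
        coeff_a A B p1 h d1 x
          = (x^4 - 4 * h^2 + 4) / ((x^4 + 4 * (A^2 - h) * x^2 + 4 * h^2 - 4) * x) \<and>
        coeff_b A B p1 h d1 x
          = d1^2 * x^2 / (x^4 + 4 * (A^2 - h) * x^2 + 4 * h^2 - 4)) \<and>
     (\<forall>I. admissible_interval A h I \<longrightarrow>
        (\<exists>s. sqrt_branch_on (quartic A h) I s) \<and>
        (\<forall>s. sqrt_branch_on (quartic A h) I s \<longrightarrow>
           (\<exists>\<Phi>. antiderivative_on (\<lambda>x. of_real (d1 * x) / s x) I \<Phi>) \<and>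
           (\<forall>\<Phi>. antiderivative_on (\<lambda>x. of_real (d1 * x) / s x) I \<Phi> \<longrightarrow>
              (\<forall>u. solves_on (coeff_a A B p1 h d1) (coeff_b A B p1 h d1) I u \<longleftrightarrow>
                 (\<exists>C1 C2 :: complex. \<forall>x\<in>I. u x = C1 * cos (\<Phi> x) + C2 * sin (\<Phi> x))))) \<and>
        (\<exists>u. solves_on (coeff_a A B p1 h d1) (coeff_b A B p1 h d1) I u \<and>
             (\<exists>x\<in>I. u x \<noteq> 0) \<and> liouvillian_on I u) \<and>
        (\<forall>u. solves_on (coeff_a A B p1 h d1) (coeff_b A B p1 h d1) I u \<longrightarrow>
             liouvillian_on I u))"
proof -
  have B: "B = 2 * A" and p1: "p1 = 2 * A * h" using assms by auto
  let ?a = "coeff_a A B p1 h d1" and ?b = "coeff_b A B p1 h d1"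
  have interval: "(\<exists>s. sqrt_branch_on (quartic A h) I s) \<and>
        (\<forall>s. sqrt_branch_on (quartic A h) I s \<longrightarrow>
           (\<exists>\<Phi>. antiderivative_on (\<lambda>x. of_real (d1 * x) / s x) I \<Phi>) \<and>
           (\<forall>\<Phi>. antiderivative_on (\<lambda>x. of_real (d1 * x) / s x) I \<Phi> \<longrightarrow>
              (\<forall>u. solves_on ?a ?b I u \<longleftrightarrow>
                 (\<exists>C1 C2 :: complex. \<forall>x\<in>I. u x = C1 * cos (\<Phi> x) + C2 * sin (\<Phi> x))))) \<and>
        (\<exists>u. solves_on ?a ?b I u \<and> (\<exists>x\<in>I. u x \<noteq> 0) \<and> liouvillian_on I u) \<and>
        (\<forall>u. solves_on ?a ?b I u \<longrightarrow> liouvillian_on I u)"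
    if adm: "admissible_interval A h I" for I
  proof -
    obtain s0 \<Phi>0 where s0: "sqrt_branch_on (quartic A h) I s0"
      and \<Phi>0: "antiderivative_on (\<lambda>x. of_real (d1 * x) / s0 x) I \<Phi>0"
      and liou: "\<And>C1 C2. liouvillian_on I (\<lambda>x. C1 * cos (\<Phi>0 x) + C2 * sin (\<Phi>0 x))"
      and sol: "\<And>s \<Phi> u. sqrt_branch_on (quartic A h) I s \<Longrightarrow>
         antiderivative_on (\<lambda>x. of_real (d1 * x) / s x) I \<Phi> \<Longrightarrow>
         solves_on ?a ?b I u \<longleftrightarrow> (\<exists>C1 C2. \<forall>x\<in>I. u x = C1 * cos (\<Phi> x) + C2 * sin (\<Phi> x))"
      using reduced_equation_on_interval[OF assms(4) adm] unfolding B p1 by blast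
    obtain x0 where x0: "x0 \<in> I" using adm unfolding admissible_interval_def by blast
    have anti: "\<exists>\<Phi>. antiderivative_on (\<lambda>x. of_real (d1 * x) / s x) I \<Phi>"
      if s: "sqrt_branch_on (quartic A h) I s" for s
    proof -
      have "s0 x \<noteq> 0" if "x \<in> I" for x
        using s0 adm that unfolding sqrt_branch_on_def admissible_interval_def
        by (metis of_real_eq_0_iff zero_power2)
      then obtain e where e: "e = 1 \<or> e = -1" and se: "\<And>x. x \<in> I \<Longrightarrow> s x = e * s0 x"
        using sqrt_branch_unique[of I s s0] s s0 adm is_interval_connected
        unfolding sqrt_branch_on_def admissible_interval_def by metis
      \<comment> \<open>Changing the sign of the branch changes the sign of its
        antiderivative.\<close>
      have "((\<lambda>x. e * \<Phi>0 x) has_vector_derivative of_real (d1 * x) / s x) (at x within I)"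
        if x: "x \<in> I" for x
      proof -
        have "(\<Phi>0 has_vector_derivative of_real (d1 * x) / s0 x) (at x within I)"
          using \<Phi>0 x unfolding antiderivative_on_def by blast
        from has_vector_derivative_mult_right[OF this, of e] show ?thesis
          using e se[OF x] by auto
      qed
      then show ?thesis unfolding antiderivative_on_def by blast
    qed
    have all_liou: "liouvillian_on I u" if u: "solves_on ?a ?b I u" for u
    proof -
      obtain C1 C2 where C: "\<And>x. x \<in> I \<Longrightarrow> u x = C1 * cos (\<Phi>0 x) + C2 * sin (\<Phi>0 x)"
        using sol[OF s0 \<Phi>0] u by blast
      \<comment> \<open>\<open>liouvillian_on\<close> depends only on the values on
        \<open>I\<close>, where \<open>u\<close> and the combination agree.\<close>
      then show ?thesis using liou[of C1 C2] unfolding liouvillian_on_def by metis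
    qed
    \<comment> \<open>This is \<open>cos (\<Phi>0 x - \<Phi>0 x0)\<close>, a solution with value 1
      at \<open>x0\<close> whatever \<open>\<Phi>0 x0\<close> is.\<close>
    define u0 where "u0 = (\<lambda>x. cos (\<Phi>0 x0) * cos (\<Phi>0 x) + sin (\<Phi>0 x0) * sin (\<Phi>0 x))"
    have "solves_on ?a ?b I u0" using sol[OF s0 \<Phi>0] unfolding u0_def by blast
    moreover have "u0 x0 = 1"
      using sin_cos_squared_add3[of "\<Phi>0 x0"] by (simp add: u0_def)
    ultimately have "\<exists>u. solves_on ?a ?b I u \<and> (\<exists>x\<in>I. u x \<noteq> 0) \<and> liouvillian_on I u"
      using x0 all_liou zero_neq_one by metis
    then show ?thesis
      using s0 anti sol all_liou by (intro conjI allI impI) blast+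
  qed
  have coeffs: "coeff_a A B p1 h d1 x
          = (x^4 - 4 * h^2 + 4) / ((x^4 + 4 * (A^2 - h) * x^2 + 4 * h^2 - 4) * x) \<and>
        coeff_b A B p1 h d1 x
          = d1^2 * x^2 / (x^4 + 4 * (A^2 - h) * x^2 + 4 * h^2 - 4)"
    if "x \<noteq> 0 \<and> quartic A h x \<noteq> 0" for x
    using that coeff_a_reduced[OF assms(4), of x A h] coeff_b_reduced[of x A h d1]
    unfolding B p1 by (simp add: quartic_def)
  show ?thesis
    by (intro conjI[OF _ allI[OF impI[OF interval]]] allI impI coeffs)
qed

end
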